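(* Let $\ell,m\in\mathbb{N}$. There exist two sets $A,A'\subset\mathbb{N}$ with $\underline{\mathrm{d}}(A)=1/2$ and $\underline{\mathrm{d}}(A')=1-\frac{1}{2(\ell+m)}$ such that for any infinite set $B\subset\mathbb{N}$ and any integer $t\in\mathbb{N}$ we have $$\{mb_1+\ell b_2 : b_1,b_2\in B,\ b_1\le b_2\}+t\not\subset A\quad\text{and}\quad \{mb_1+\ell b_2 : b_1,b_2\in B,\ b_1\le b_2\}\not\subset A'.$$
   Context: $\mathbb{N}=\{1,2,3,\dots\}$. The lower density of $A\subset\mathbb{N}$ is $\underline{\mathrm{d}}(A)=\liminf_{N\to\infty}\frac{|A\cap\{1,\dots,N\}|}{N}$. For a set $C$ of integers and an integer $t$, $C+t=\{c+t: c\in C\}$. *)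

theory Defs
  imports "HOL-Analysis.Analysis"
begin

(* Sets of positive integers are subsets of {1..} :: nat set.  The liminf is taken in the
   complete lattice ereal; the junk term at N = 0 (namely 0 / 0 = 0) does not affect it. *)
definition lower_density :: "nat set \<Rightarrow> ereal" where
  "lower_density A = liminf (\<lambda>N. ereal (real (card (A \<inter> {1..N})) / real N))"

definition weighted_sums :: "nat \<Rightarrow> nat \<Rightarrow> nat set \<Rightarrow> nat set" where
  "weighted_sums m l B = {m * b1 + l * b2 | b1 b2. b1 \<in> B \<and> b2 \<in> B \<and> b1 \<le> b2}"

definition translate :: "nat set \<Rightarrow> nat \<Rightarrow> nat set" where
  "translate C t = {c + t | c. c \<in> C}"

end

theory Submission
  imports Defs "HOL-Real_Asymp.Real_Asymp"
begin

text \<open>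
  Put \<open>q = l + m\<close> and \<open>lam = q / l > 1\<close>. Everything rests on a set \<open>E\<close> of natural density \<open>1/2\<close>
  such that, for every constant \<open>C\<close>, only finitely many \<open>n \<in> E\<close> have an element of \<open>E\<close> within
  distance \<open>C\<close> of \<open>n / lam\<close> (\<open>density_dilate_avoiding\<close>, \<open>finite_dilate_coincidences\<close>).

  Take \<open>A = E\<close>. If \<open>E\<close> contained all shifted sums over an infinite \<open>B\<close>, then for a fixed \<open>b1 \<in> B\<close> and
  all larger \<open>b \<in> B\<close> it would contain both \<open>q b + t\<close> (the sum of \<open>b\<close> with itself) and
  \<open>m b1 + l b + t\<close>, which differs from \<open>(q b + t) / lam\<close> by an amount independent of \<open>b\<close>; this is
  impossible for large \<open>b\<close>. Without a shift the sums of \<open>b\<close> with itself are multiples of \<open>q\<close>, so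
  it suffices to thin out those multiples: \<open>A'\<close> consists of all non-multiples of \<open>q\<close> together with
  \<open>q E\<close>, and has density \<open>1 - 1 / (2 q)\<close>. By the pigeonhole principle infinitely many elements
  of \<open>B\<close> lie in one residue class modulo \<open>q\<close>; for \<open>b1\<close> and \<open>b\<close> in that class \<open>m b1 + l b\<close> is a
  multiple of \<open>q\<close> too, so \<open>E\<close> would contain \<open>b\<close> and \<open>(m b1 + l b) / q = b / lam + const\<close>.

  The set \<open>E\<close> is built level by level, the level \<open>j\<close> being the interval from \<open>lam ^ j\<close> to
  \<open>lam ^ (j + 1)\<close>. It is cut into blocks of equal length, and every second block belongs to \<open>E\<close>,
  with the parity of the chosen blocks reversed from one level to the next. If the block length
  were exactly proportional to \<open>lam ^ j\<close>, then division by \<open>lam\<close> would map chosen blocks to rejected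
  ones, as desired, but the number of blocks per level would stay bounded and the density
  would oscillate. With block length \<open>lam ^ j / sqrt (j + 1)\<close> there are more and more blocks, each
  negligible compared with its level, so the density exists. On the other hand \<open>sqrt\<close> grows so slowly
  that division by \<open>lam\<close> displaces the \<open>O (sqrt j)\<close> blocks of level \<open>j\<close>, relative to those of
  level \<open>j - 1\<close>, by only \<open>O (1 / sqrt j)\<close> of a block length. Removing a margin of relative size
  \<open>j powr (-1/4)\<close> at both ends of every block absorbs this displacement and every bounded
  perturbation, and costs no density.
\<close>

section \<open>Counting periodic sets\<close>

lemma card_periodic_window:
  fixes S :: "nat set"
  assumes per: "\<And>n. n + T \<in> S \<longleftrightarrow> n \<in> S"
  shows "card (S \<inter> {a..<a+T}) = card (S \<inter> {..<T})"
proof (cases "T = 0")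
  case False
  show ?thesis
  proof (induction a)
    case 0
    show ?case by (simp add: atLeast0LessThan)
  next
    case (Suc a)
    have s1: "{a..<a+T} = insert a {Suc a..<a+T}" and s2: "{Suc a..<Suc a+T} = insert (a+T) {Suc a..<a+T}"
      using False by auto
    have "card (S \<inter> {Suc a..<Suc a+T}) = card (S \<inter> {a..<a+T})"
      unfolding s1 s2 using per[of a] by (cases "a \<in> S") auto
    with Suc show ?case by simp
  qed
qed simp

lemma card_periodic_windows:
  fixes S :: "nat set"
  assumes per: "\<And>n. n + T \<in> S \<longleftrightarrow> n \<in> S"
  shows "card (S \<inter> {a..<a+k*T}) = k * card (S \<inter> {..<T})"
proof (induction k)
  case (Suc k)
  have "card ((S \<inter> {a..<a+k*T}) \<union> (S \<inter> {a+k*T..<a+k*T+T}))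
      = card (S \<inter> {a..<a+k*T}) + card (S \<inter> {a+k*T..<a+k*T+T})"
    by (rule card_Un_disjoint) auto
  moreover have "(S \<inter> {a..<a+k*T}) \<union> (S \<inter> {a+k*T..<a+k*T+T}) = S \<inter> {a..<a+Suc k*T}"
    by auto
  ultimately have "card (S \<inter> {a..<a+Suc k*T})
      = card (S \<inter> {a..<a+k*T}) + card (S \<inter> {a+k*T..<a+k*T+T})"
    by simp
  with Suc card_periodic_window[OF per, where a = "a+k*T"] show ?case by simp
qed simp

lemma card_periodic_interval:
  fixes S :: "nat set"
  assumes per: "\<And>n. n + T \<in> S \<longleftrightarrow> n \<in> S" and "T > 0" "a \<le> b"
  defines "c \<equiv> card (S \<inter> {..<T})"
  shows "\<bar>real (card (S \<inter> {a..<b})) - (real b - real a) * c / T\<bar> \<le> c"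
proof -
  define k where "k = (b - a) div T"
  have "k * T \<le> b - a" "b - a < Suc k * T"
    unfolding k_def using \<open>T > 0\<close> by (simp, metis dividend_less_div_times mult.commute mult_Suc)
  then have k: "a + k * T \<le> b" "b \<le> a + Suc k * T" using \<open>a \<le> b\<close> by linarith+
  have "k * c \<le> card (S \<inter> {a..<b})"
    unfolding c_def card_periodic_windows[OF per, symmetric, where a = a]
    using k by (intro card_mono) auto
  moreover have "card (S \<inter> {a..<b}) \<le> Suc k * c"
    unfolding c_def card_periodic_windows[OF per, symmetric, where a = a]
    using k by (intro card_mono) auto
  ultimately have "real (k * c) \<le> card (S \<inter> {a..<b})" "card (S \<inter> {a..<b}) \<le> real (Suc k * c)"
    using of_nat_mono by blast+
  then have 1: "real k * c \<le> card (S \<inter> {a..<b})" "card (S \<inter> {a..<b}) \<le> (real k + 1) * c"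
    by (simp_all add: algebra_simps)
  have "real (a + k * T) \<le> b" "real b \<le> real (a + Suc k * T)" using k of_nat_le_iff by blast+
  then have "real k \<le> (real b - real a) / T" "(real b - real a) / T \<le> real k + 1"
    using \<open>T > 0\<close> by (auto simp: field_simps)
  then have "real k * c \<le> (real b - real a) / T * c" "(real b - real a) / T * c \<le> (real k + 1) * c"
    by (intro mult_right_mono; simp)+
  with 1 show ?thesis by (simp add: algebra_simps abs_le_iff)
qed

text \<open>
  Blocks \<open>{a * h..<(a + 1) * h}\<close> with \<open>a \<equiv> j\<close> modulo 2, each shortened by \<open>d\<close> at both ends.
\<close>

definition alternating_blocks :: "nat \<Rightarrow> nat \<Rightarrow> nat \<Rightarrow> nat set" where
  "alternating_blocks h d j = {n. even (n div h + j) \<and> d \<le> n mod h \<and> n mod h + d < h}"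

text \<open>
  The set has period \<open>2 * h\<close>, and one period contains \<open>h - 2 * d\<close> of its elements. The first error
  term comes from an incomplete period, the second from the margins.
\<close>

lemma card_alternating_blocks:
  assumes "h > 0" "a \<le> b"
  shows "\<bar>real (card (alternating_blocks h d j \<inter> {a..<b})) - (real b - real a) / 2\<bar>
           \<le> h + (real b - real a) * (d / h)"
proof -
  let ?S = "alternating_blocks h d j"
  define c where "c = card (?S \<inter> {..<2*h})"
  have per: "n + 2 * h \<in> ?S \<longleftrightarrow> n \<in> ?S" for n
    using \<open>h > 0\<close> by (simp add: alternating_blocks_def)
  \<comment> \<open>Start of the chosen block within the period \<open>{..<2 * h}\<close>.\<close>
  define s where "s = (if even j then 0 else h)"
  have "?S \<inter> {..<2*h} = {s+d..<s+h-d}"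
  proof (intro set_eqI)
    fix n
    consider "n < h" | "h \<le> n" "n < 2*h" | "2*h \<le> n" by linarith
    then show "n \<in> ?S \<inter> {..<2*h} \<longleftrightarrow> n \<in> {s+d..<s+h-d}"
    proof cases
      case 2
      then have "n div h = 1" "n mod h = n - h"
        by (simp_all add: div_nat_eqI le_mod_geq)
      with 2 show ?thesis by (auto simp: alternating_blocks_def s_def)
    qed (auto simp: alternating_blocks_def s_def)
  qed
  then have c: "c = h - 2 * d" unfolding c_def by simp
  have cr: "real c / (2*h) - 1/2 \<le> 0" "- (d / h) \<le> real c / (2*h) - 1/2"
    unfolding c using \<open>h > 0\<close> by (auto simp: field_simps)
  have "(real b - real a) * (real c / (2*h) - 1/2) \<le> 0"
    using cr(1) \<open>a \<le> b\<close> by (intro mult_nonneg_nonpos) auto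
  moreover have "(real b - real a) * (- (d / h)) \<le> (real b - real a) * (real c / (2*h) - 1/2)"
    using cr(2) \<open>a \<le> b\<close> by (intro mult_left_mono) auto
  moreover have "\<bar>real (card (?S \<inter> {a..<b})) - (real b - real a) * c / (2*h)\<bar> \<le> c"
    using card_periodic_interval[where S = ?S and T = "2*h", OF per _ \<open>a \<le> b\<close>] \<open>h > 0\<close>
    unfolding c_def by simp
  moreover have "real c \<le> h" unfolding c by simp
  moreover have "(real b - real a) * (real c / (2*h) - 1/2)
      = (real b - real a) * c / (2*h) - (real b - real a) / 2"
    by (simp add: algebra_simps)
  ultimately show ?thesis by (simp only: mult_minus_right)
qed

section \<open>Density from counts on geometric scales\<close>

locale geometric_scales =
  fixes lam :: real
  assumes lam: "lam > 1"
begin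

definition scale :: "nat \<Rightarrow> nat" where "scale j = nat \<lceil>lam ^ j\<rceil>"

lemma less_scale_iff: "n < scale j \<longleftrightarrow> real n < lam ^ j"
  unfolding scale_def by linarith

lemma scale_le_iff: "scale j \<le> n \<longleftrightarrow> lam ^ j \<le> n"
  using less_scale_iff[of n j] by linarith

lemma mono_scale: "i \<le> j \<Longrightarrow> scale i \<le> scale j"
  unfolding scale_def using lam by (intro nat_mono ceiling_mono power_increasing) auto

lemma level_unique:
  assumes "scale i \<le> n" "n < scale (Suc i)" "scale j \<le> n" "n < scale (Suc j)"
  shows "i = j"
proof (rule ccontr)
  assume "i \<noteq> j"
  then have "Suc i \<le> j \<or> Suc j \<le> i" by linarith
  with assms mono_scale[of "Suc i" j] mono_scale[of "Suc j" i] show False by linarith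
qed

lemma level_exists:
  assumes "scale i \<le> n"
  obtains j where "i \<le> j" "scale j \<le> n" "n < scale (Suc j)"
proof -
  obtain k where "real n < lam ^ k" using real_arch_pow[OF lam] ..
  then have k: "n < scale k" by (simp add: less_scale_iff)
  define m where "m = (LEAST k. n < scale k)"
  have m: "n < scale m" unfolding m_def using k by (rule LeastI)
  have "m > i" using assms m mono_scale[of m i] by (meson le_trans not_le)
  then obtain j where j: "m = Suc j" "i \<le> j" by (cases m) auto
  have "\<not> n < scale j" using j(1) not_less_Least[of j "\<lambda>k. n < scale k"] unfolding m_def by simp
  then show thesis using that[OF j(2)] m unfolding j(1) by simp
qed

text \<open>
  An error that is negligible on each single level remains negligible after summation, because
  the level sizes grow geometrically: the errors up to level \<open>j\<close> form a geometric sum, which is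
  dominated by its last term.
\<close>

lemma density_half_from_levels:
  fixes E :: "nat set"
  assumes lev: "\<And>j a b. scale j \<le> a \<Longrightarrow> a \<le> b \<Longrightarrow> b \<le> scale (Suc j) \<Longrightarrow>
                  \<bar>real (card (E \<inter> {a..<b})) - (real b - real a) / 2\<bar> \<le> e j"
    and e: "(\<lambda>j. e j / lam ^ j) \<longlonglongrightarrow> 0"
  shows "(\<lambda>N. real (card (E \<inter> {1..N})) / N) \<longlonglongrightarrow> 1/2"
proof -
  define F where "F N = real (card (E \<inter> {..<N})) - real N / 2" for N
  have F_diff: "\<bar>F b - F a\<bar> \<le> e j" if "scale j \<le> a" "a \<le> b" "b \<le> scale (Suc j)" for a b j
  proof -
    have "{..<b} = {..<a} \<union> {a..<b}" using that(2) by auto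
    then have "E \<inter> {..<b} = (E \<inter> {..<a}) \<union> (E \<inter> {a..<b})" by blast
    moreover have "card ((E \<inter> {..<a}) \<union> (E \<inter> {a..<b})) = card (E \<inter> {..<a}) + card (E \<inter> {a..<b})"
      by (rule card_Un_disjoint) auto
    ultimately have "card (E \<inter> {..<b}) = card (E \<inter> {..<a}) + card (E \<inter> {a..<b})" by simp
    then have "F b - F a = real (card (E \<inter> {a..<b})) - (real b - real a) / 2"
      unfolding F_def by (simp add: diff_divide_distrib)
    with lev[OF that] show ?thesis by simp
  qed
  have main: "\<exists>K. \<forall>\<^sub>F N in sequentially. \<bar>F N\<bar> \<le> K + \<epsilon> * real N" if "\<epsilon> > 0" for \<epsilon> :: real
  proof -
    \<comment> \<open>Errors \<open>\<delta> * lam ^ i\<close> for \<open>i \<le> j\<close> add up to less than \<open>\<delta> * lam / (lam - 1) * lam ^ j\<close>.\<close>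
    define \<delta> where "\<delta> = \<epsilon> * (lam - 1) / lam"
    have \<delta>: "\<delta> > 0" "\<delta> * (lam / (lam - 1)) = \<epsilon>" using that lam by (auto simp: \<delta>_def)
    have "\<forall>\<^sub>F j in sequentially. e j / lam ^ j < \<delta>" using order_tendstoD(2)[OF e] \<delta> by blast
    then have "\<forall>\<^sub>F j in sequentially. e j \<le> \<delta> * lam ^ j"
    proof eventually_elim
      case (elim j)
      with lam show ?case by (simp add: pos_divide_less_eq)
    qed
    then obtain i where i: "e j \<le> \<delta> * lam ^ j" if "j \<ge> i" for j
      unfolding eventually_sequentially by blast
    define K where "K = \<bar>F (scale i)\<bar>"
    have geom: "\<delta> * (lam ^ j / (lam - 1)) + \<delta> * lam ^ j = \<delta> * (lam * lam ^ j / (lam - 1))" for j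
      using lam by (simp add: divide_simps) (simp add: algebra_simps)
    have F_scale: "\<bar>F (scale j)\<bar> \<le> K + \<delta> * (lam ^ j / (lam - 1))" if "i \<le> j" for j
      using that
    proof (induction j rule: dec_induct)
      case base
      show ?case unfolding K_def using \<delta> lam by simp
    next
      case (step j)
      have "\<bar>F (scale (Suc j)) - F (scale j)\<bar> \<le> e j" by (rule F_diff) (simp_all add: mono_scale)
      also have "\<dots> \<le> \<delta> * lam ^ j" using step(1) by (rule i)
      finally show ?case using step.IH geom[of j] unfolding power_Suc by linarith
    qed
    have "\<bar>F N\<bar> \<le> K + \<epsilon> * N" if N: "N \<ge> scale i" for N
    proof -
      obtain j where j: "i \<le> j" "scale j \<le> N" "N < scale (Suc j)" using level_exists[OF N] .
      have "\<bar>F N - F (scale j)\<bar> \<le> e j" by (rule F_diff) (use j in simp_all)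
      also have "\<dots> \<le> \<delta> * lam ^ j" using j(1) by (rule i)
      finally have "\<bar>F N\<bar> \<le> K + \<delta> * (lam * lam ^ j / (lam - 1))"
        using F_scale[OF j(1)] geom[of j] by linarith
      also have "\<delta> * (lam * lam ^ j / (lam - 1)) = \<epsilon> * lam ^ j" unfolding \<delta>(2)[symmetric] by simp
      also have "\<dots> \<le> \<epsilon> * N" using j(2) \<open>\<epsilon> > 0\<close> unfolding scale_le_iff by simp
      finally show ?thesis by simp
    qed
    then show ?thesis by (intro exI[of _ K] eventually_sequentiallyI)
  qed
  have close: "\<bar>real (card (E \<inter> {1..N})) - N / 2\<bar> \<le> \<bar>F N\<bar> + 1" for N
  proof -
    have "card (E \<inter> {1..N}) \<le> card (insert N (E \<inter> {..<N}))" by (intro card_mono) auto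
    also have "\<dots> \<le> card (E \<inter> {..<N}) + 1" by (simp add: card_insert_if)
    finally have 1: "card (E \<inter> {1..N}) \<le> card (E \<inter> {..<N}) + 1" .
    have "card (E \<inter> {..<N}) \<le> card (insert 0 (E \<inter> {1..N}))" by (intro card_mono) auto
    also have "\<dots> \<le> card (E \<inter> {1..N}) + 1" by (simp add: card_insert_if)
    finally show ?thesis using 1 unfolding F_def by linarith
  qed
  show ?thesis
  proof (rule tendstoI)
    fix \<epsilon> :: real assume "\<epsilon> > 0"
    then obtain K where K: "\<forall>\<^sub>F N in sequentially. \<bar>F N\<bar> \<le> K + \<epsilon>/2 * N" using main[of "\<epsilon>/2"] by auto
    have "\<forall>\<^sub>F N in sequentially. (K + 1) / (\<epsilon>/2) < real N"
      by (rule eventually_compose_filterlim[OF eventually_gt_at_top filterlim_real_sequentially])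
    with K eventually_gt_at_top[of 0]
    show "\<forall>\<^sub>F N in sequentially. dist (real (card (E \<inter> {1..N})) / N) (1/2) < \<epsilon>"
    proof eventually_elim
      case (elim N)
      have "\<bar>real (card (E \<inter> {1..N})) - N / 2\<bar> < \<epsilon> * N"
      proof -
        have "K + 1 < \<epsilon>/2 * N"
          using elim(3) \<open>\<epsilon> > 0\<close> by (simp add: pos_divide_less_eq mult.commute)
        with elim(1) close[of N] show ?thesis by linarith
      qed
      then have "\<bar>real (card (E \<inter> {1..N})) - N / 2\<bar> / N < \<epsilon>"
        using elim(2) by (simp add: pos_divide_less_eq)
      moreover have "real (card (E \<inter> {1..N})) / N - 1/2 = (real (card (E \<inter> {1..N})) - N / 2) / N"
        using elim(2) by (simp add: diff_divide_distrib)
      ultimately show ?case by (simp add: dist_real_def abs_divide)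
    qed
  qed
qed

section \<open>A set of density one half that avoids its own dilate\<close>

definition block :: "nat \<Rightarrow> nat" where
  "block j = nat \<lceil>lam ^ j / sqrt (real j + 1)\<rceil>"

definition margin :: "nat \<Rightarrow> nat" where
  "margin j = nat \<lceil>lam ^ j / (real j + 1) powr (3/4)\<rceil>"

text \<open>
  Leaving out \<open>j\<close> points at either end of level \<open>j\<close> ensures that a number within bounded distance
  of \<open>n / lam\<close>, for a large element \<open>n\<close> of level \<open>j + 1\<close>, really lies in level \<open>j\<close>. Since \<open>j\<close>
  is negligible compared with \<open>lam ^ j\<close>, this does not affect the density.
\<close>

definition dilate_avoiding :: "nat set" where
  "dilate_avoiding = {n. \<exists>j. scale j + j \<le> n \<and> n + j < scale (Suc j)
                            \<and> n \<in> alternating_blocks (block j) (margin j) j}"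

lemma block_bounds: "lam ^ j / sqrt (real j + 1) \<le> block j" "block j \<le> lam ^ j / sqrt (real j + 1) + 1"
proof -
  have "0 \<le> lam ^ j / sqrt (real j + 1)" using lam by simp
  then show "lam ^ j / sqrt (real j + 1) \<le> block j" "block j \<le> lam ^ j / sqrt (real j + 1) + 1"
    unfolding block_def by linarith+
qed

lemma margin_bounds:
  "lam ^ j / (real j + 1) powr (3/4) \<le> margin j" "margin j \<le> lam ^ j / (real j + 1) powr (3/4) + 1"
proof -
  have "0 \<le> lam ^ j / (real j + 1) powr (3/4)" using lam by simp
  then show "lam ^ j / (real j + 1) powr (3/4) \<le> margin j" "margin j \<le> lam ^ j / (real j + 1) powr (3/4) + 1"
    unfolding margin_def by linarith+
qed

lemma block_pos: "block j > 0"
proof -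
  have "0 < lam ^ j / sqrt (real j + 1)" using lam by (simp add: add_nonneg_pos)
  with block_bounds(1)[of j] have "0 < real (block j)" by linarith
  then show ?thesis by simp
qed

lemma dilate_avoiding_positive: "dilate_avoiding \<subseteq> {1..}"
proof
  fix n assume "n \<in> dilate_avoiding"
  then obtain j where "scale j + j \<le> n" unfolding dilate_avoiding_def by blast
  then have "scale j \<le> n" by linarith
  then have "lam ^ j \<le> n" by (simp add: scale_le_iff)
  moreover have "1 \<le> lam ^ j" using lam by simp
  ultimately show "n \<in> {1..}" by simp
qed

text \<open>
  Within one level the set agrees with a set of alternating blocks, except at the \<open>2 * j\<close> points
  left out at the ends.
\<close>

lemma card_dilate_avoiding_level:
  assumes ab: "scale j \<le> a" "a \<le> b" "b \<le> scale (Suc j)"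
  shows "\<bar>real (card (dilate_avoiding \<inter> {a..<b})) - (real b - real a) / 2\<bar>
          \<le> block j + lam ^ Suc j * (margin j / block j) + 2 * real j"
proof -
  let ?E = "dilate_avoiding" and ?S = "alternating_blocks (block j) (margin j) j"
  let ?G = "{scale j..<scale j + j} \<union> {scale (Suc j) - j..<scale (Suc j)}"
  have sub: "?E \<inter> {a..<b} \<subseteq> ?S \<inter> {a..<b}"
  proof
    fix n assume n: "n \<in> ?E \<inter> {a..<b}"
    then obtain i where i: "scale i + i \<le> n" "n + i < scale (Suc i)"
      "n \<in> alternating_blocks (block i) (margin i) i"
      unfolding dilate_avoiding_def by auto
    have "i = j" using level_unique[of i n j] i n ab by auto
    with i n show "n \<in> ?S \<inter> {a..<b}" by simp
  qed
  have sup: "?S \<inter> {a..<b} \<subseteq> (?E \<inter> {a..<b}) \<union> ?G"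
  proof
    fix n assume n: "n \<in> ?S \<inter> {a..<b}"
    show "n \<in> (?E \<inter> {a..<b}) \<union> ?G"
    proof (cases "scale j + j \<le> n \<and> n + j < scale (Suc j)")
      case True
      with n have "n \<in> ?E" unfolding dilate_avoiding_def by blast
      with n show ?thesis by blast
    next
      case False
      with n ab show ?thesis by (auto simp del: le_diff_conv)
    qed
  qed
  have "card ?G \<le> j + j" by (rule order_trans[OF card_Un_le]) simp
  moreover have "card (?S \<inter> {a..<b}) \<le> card ((?E \<inter> {a..<b}) \<union> ?G)"
    by (intro card_mono sup) auto
  moreover have "card ((?E \<inter> {a..<b}) \<union> ?G) \<le> card (?E \<inter> {a..<b}) + card ?G"
    by (rule card_Un_le)
  ultimately have 1: "card (?S \<inter> {a..<b}) \<le> card (?E \<inter> {a..<b}) + 2 * j" by linarith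
  have 2: "card (?E \<inter> {a..<b}) \<le> card (?S \<inter> {a..<b})" by (intro card_mono sub) auto
  have "real b \<le> real (scale (Suc j))" using ab by simp
  also have "\<dots> \<le> lam ^ Suc j + 1"
    using less_scale_iff[of "scale (Suc j) - 1" "Suc j"] lam by (cases "scale (Suc j)") auto
  finally have "real b \<le> lam ^ Suc j + 1" .
  moreover have "1 \<le> real a" using ab(1) one_le_power[of lam j] lam unfolding scale_le_iff by linarith
  ultimately have "(real b - real a) * (margin j / block j) \<le> lam ^ Suc j * (margin j / block j)"
    by (intro mult_right_mono) auto
  with card_alternating_blocks[OF block_pos[of j] ab(2), where d = "margin j" and j = j] 1 2 show ?thesis
    by linarith
qed

lemma density_dilate_avoiding:
  "(\<lambda>N. real (card (dilate_avoiding \<inter> {1..N})) / N) \<longlonglongrightarrow> 1/2"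
proof (rule density_half_from_levels)
  let ?e = "\<lambda>j. (block j + lam ^ Suc j * (margin j / block j) + 2 * real j) / lam ^ j"
  show "\<bar>real (card (dilate_avoiding \<inter> {a..<b})) - (real b - real a) / 2\<bar>
          \<le> block j + lam ^ Suc j * (margin j / block j) + 2 * real j"
    if "scale j \<le> a" "a \<le> b" "b \<le> scale (Suc j)" for j a b
    using that by (rule card_dilate_avoiding_level)
  let ?u = "\<lambda>j::nat. (lam ^ j / sqrt (real j + 1) + 1
     + lam ^ Suc j * ((lam ^ j / (real j + 1) powr (3/4) + 1) / (lam ^ j / sqrt (real j + 1))) + 2 * real j) / lam ^ j"
  have u: "?u \<longlonglongrightarrow> 0" using lam by real_asymp
  have "?e j \<le> ?u j" for j
  proof -
    have "0 < lam ^ j / sqrt (real j + 1)" using lam by (simp add: add_nonneg_pos)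
    moreover have "0 \<le> lam ^ j / (real j + 1) powr (3/4) + 1"
      using margin_bounds(2)[of j] by linarith
    ultimately have "margin j / block j
        \<le> (lam ^ j / (real j + 1) powr (3/4) + 1) / (lam ^ j / sqrt (real j + 1))"
      by (intro frac_le block_bounds margin_bounds)
    then have "lam ^ Suc j * (margin j / block j)
        \<le> lam ^ Suc j * ((lam ^ j / (real j + 1) powr (3/4) + 1) / (lam ^ j / sqrt (real j + 1)))"
      by (rule mult_left_mono) (use lam in simp)
    moreover have "0 \<le> lam ^ j" using lam by simp
    ultimately show ?thesis
      by (intro divide_right_mono add_mono order_refl block_bounds(2))
  qed
  moreover have "0 \<le> ?e j" for j using lam by simp
  ultimately show "?e \<longlonglongrightarrow> 0"
    by (intro real_tendsto_sandwich[OF _ _ tendsto_const u] always_eventually allI)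
qed

text \<open>
  How far the blocks of two consecutive levels are from being exact dilates of each other: the main
  term is the change of \<open>1 / sqrt\<close>, the rest is rounding.
\<close>

lemma block_ratio:
  "\<bar>real (block (Suc j)) - lam * block j\<bar>
     \<le> lam ^ Suc j * (1 / sqrt (real j + 1) - 1 / sqrt (real j + 2)) + lam + 1"
proof -
  have b: "lam * (lam ^ j / sqrt (real j + 1)) \<le> lam * block j"
    "lam * block j \<le> lam * (lam ^ j / sqrt (real j + 1) + 1)"
    by (intro mult_left_mono block_bounds; use lam in simp)+
  have "lam ^ Suc j * (1 / sqrt (real j + 2)) \<le> lam ^ Suc j * (1 / sqrt (real j + 1))"
    using lam by (intro mult_left_mono frac_le) auto
  moreover have "lam ^ Suc j / sqrt (real j + 2) \<le> block (Suc j)"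
    "block (Suc j) \<le> lam ^ Suc j / sqrt (real j + 2) + 1"
    using block_bounds[of "Suc j"] by (simp_all add: add.commute)
  moreover have "lam * (lam ^ j / sqrt (real j + 1)) = lam ^ Suc j / sqrt (real j + 1)" by simp
  ultimately show ?thesis
    using b lam by (simp only: ring_distribs mult_1_right times_divide_eq_right)
qed

text \<open>
  For \<open>\<bar>lam * k - n\<bar> \<le> C\<close> and \<open>n\<close> in level \<open>j + 1\<close>, the left-hand side bounds the distance between the
  positions of \<open>k\<close> and \<open>n\<close>, each measured in blocks of its own level, multiplied by
  \<open>block (Suc j)\<close>. It is of order \<open>lam ^ j / j\<close>, smaller than the margin of order
  \<open>lam ^ j / j powr (3/4)\<close>.
\<close>

lemma margin_dominates:
  fixes C :: real
  assumes C: "C \<ge> 0"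
  shows "\<forall>\<^sub>F j in sequentially. 
     (C * block (Suc j) + lam ^ (j + 2) * \<bar>real (block (Suc j)) - lam * block j\<bar>) / (lam * block j)
       < margin (Suc j)"
proof -
  let ?G = "\<lambda>j::nat. lam ^ Suc j * (1 / sqrt (real j + 1) - 1 / sqrt (real j + 2)) + lam + 1"
  have "\<forall>\<^sub>F j in sequentially. (C * (lam ^ Suc j / sqrt (real j + 2) + 1) + lam ^ (j + 2) * ?G j)
           / (lam * (lam ^ j / sqrt (real j + 1))) < lam ^ Suc j / (real j + 2) powr (3/4)"
    using lam C by real_asymp
  then show ?thesis
  proof eventually_elim
    case (elim j)
    have "(C * block (Suc j) + lam ^ (j + 2) * \<bar>real (block (Suc j)) - lam * block j\<bar>) / (lam * block j)
      \<le> (C * (lam ^ Suc j / sqrt (real j + 2) + 1) + lam ^ (j + 2) * ?G j)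
           / (lam * (lam ^ j / sqrt (real j + 1)))"
    proof (rule frac_le)
      have p: "0 < lam ^ j / sqrt (real j + 1)" using lam by (simp add: add_nonneg_pos)
      then show "0 < lam * (lam ^ j / sqrt (real j + 1))" using lam by simp
      show "lam * (lam ^ j / sqrt (real j + 1)) \<le> lam * block j"
        using lam by (intro mult_left_mono block_bounds) simp
      have "block (Suc j) \<le> lam ^ Suc j / sqrt (real j + 2) + 1"
        using block_bounds(2)[of "Suc j"] by (simp add: add.commute)
      then have "C * block (Suc j) \<le> C * (lam ^ Suc j / sqrt (real j + 2) + 1)"
        using C by (rule mult_left_mono)
      moreover have "lam ^ (j + 2) * \<bar>real (block (Suc j)) - lam * block j\<bar> \<le> lam ^ (j + 2) * ?G j"
        using lam by (intro mult_left_mono block_ratio) simp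
      ultimately show le: "C * block (Suc j) + lam ^ (j + 2) * \<bar>real (block (Suc j)) - lam * block j\<bar>
          \<le> C * (lam ^ Suc j / sqrt (real j + 2) + 1) + lam ^ (j + 2) * ?G j"
        by (rule add_mono)
      have "0 \<le> C * block (Suc j) + lam ^ (j + 2) * \<bar>real (block (Suc j)) - lam * block j\<bar>"
        using lam C by (intro add_nonneg_nonneg mult_nonneg_nonneg) auto
      with le show "0 \<le> C * (lam ^ Suc j / sqrt (real j + 2) + 1) + lam ^ (j + 2) * ?G j"
        by (rule order_trans[rotated])
    qed
    with elim margin_bounds(1)[of "Suc j"] show ?case by (simp add: add.commute)
  qed
qed

text \<open>
  The block numbers of \<open>n\<close> and \<open>k\<close> have different parities, so the position of \<open>k\<close> lies outside the
  block of \<open>n\<close>, while the position of \<open>n\<close> is at least a margin away from both ends of that block.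
\<close>

lemma blocks_separated:
  assumes n: "n \<in> alternating_blocks h d (Suc j)" and k: "k \<in> alternating_blocks h' d' j"
    and h: "h' > 0"
  shows "real d / h \<le> \<bar>real k / h' - real n / h\<bar>"
proof -
  have "h > 0" using n by (auto simp: alternating_blocks_def)
  have nd: "real n / h = real (n div h) + real (n mod h) / h" 
    using \<open>h > 0\<close> by (simp add: field_simps flip: of_nat_mult of_nat_add)
  have kd: "real k / h' = real (k div h') + real (k mod h') / h'"
    using \<open>h' > 0\<close> by (simp add: field_simps flip: of_nat_mult of_nat_add)
  have n1: "real d / h \<le> real (n mod h) / h"
    using n \<open>h > 0\<close> by (intro divide_right_mono) (auto simp: alternating_blocks_def)
  have "real (n mod h) + real d \<le> h" using n by (auto simp: alternating_blocks_def)
  then have n2: "real (n mod h) / h + real d / h \<le> 1"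
    using \<open>h > 0\<close> by (simp add: field_simps)
  have k1: "0 \<le> real (k mod h') / h'" "real (k mod h') / h' \<le> 1"
    using h by (auto simp: field_simps less_imp_le)
  have "odd (n div h + k div h')" using n k by (auto simp: alternating_blocks_def)
  then have "n div h \<noteq> k div h'" by auto
  then have "real (n div h) + 1 \<le> real (k div h') \<or> real (k div h') + 1 \<le> real (n div h)"
    by linarith
  with n1 n2 k1 nd kd show ?thesis by linarith
qed

text \<open>
  For large \<open>n\<close>, a number \<open>k\<close> close to \<open>n / lam\<close> lies exactly one level below \<open>n\<close>. Two elements of
  the set on consecutive levels have positions differing by at least a margin, whereas
  \<open>k \<approx> n / lam\<close> forces a smaller difference.
\<close>

lemma finite_dilate_coincidences:
  "finite {n \<in> dilate_avoiding. \<exists>k\<in>dilate_avoiding. \<bar>lam * real k - real n\<bar> \<le> C}"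
proof -
  define c where "c = max C 0"
  have c: "c \<ge> 0" "C \<le> c" by (auto simp: c_def)
  have "\<forall>\<^sub>F j in sequentially. c + lam \<le> real j" 
    by (rule eventually_compose_filterlim[OF eventually_ge_at_top filterlim_real_sequentially])
  from eventually_conj[OF margin_dominates[OF c(1)] this] obtain i where i:
    "\<And>j. j \<ge> i \<Longrightarrow> (c * block (Suc j) + lam ^ (j + 2) * \<bar>real (block (Suc j)) - lam * block j\<bar>)
         / (lam * block j) < margin (Suc j)" "\<And>j. j \<ge> i \<Longrightarrow> c + lam \<le> real j"
    unfolding eventually_sequentially by blast
  have "n < scale (Suc i)" if n: "n \<in> dilate_avoiding" and k: "k \<in> dilate_avoiding"
    and close: "\<bar>lam * real k - real n\<bar> \<le> C" for n k
  proof (rule ccontr)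
    assume "\<not> n < scale (Suc i)"
    then have big: "scale (Suc i) \<le> n" by simp
    obtain j' where j': "scale j' + j' \<le> n" "n + j' < scale (Suc j')"
      "n \<in> alternating_blocks (block j') (margin j') j'"
      using n unfolding dilate_avoiding_def by blast
    obtain j'' where j'': "scale j'' + j'' \<le> k" "k + j'' < scale (Suc j'')"
      "k \<in> alternating_blocks (block j'') (margin j'') j''"
      using k unfolding dilate_avoiding_def by blast
    have "\<not> Suc j' \<le> Suc i" using big j' mono_scale[of "Suc j'" "Suc i"] by linarith
    then obtain j where j: "j' = Suc j" "i \<le> j" by (cases j') auto
    have "lam ^ Suc j \<le> real (n - Suc j)" unfolding scale_le_iff[symmetric] using j'(1) unfolding j(1) by linarith
    then have n1: "lam ^ Suc j + real (Suc j) \<le> n" using j' j by linarith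
    have n2: "real n + real (Suc j) < lam ^ (j + 2)"
      using j' j less_scale_iff[of "n + Suc j" "j + 2"] by simp
    have "lam ^ Suc j \<le> lam * real k"
      using n1 close c i(2)[OF j(2)] lam by linarith
    then have k1: "scale j \<le> k" unfolding scale_le_iff using lam by simp
    have "lam * real k < lam ^ (j + 2)"
      using n2 close c i(2)[OF j(2)] lam by linarith
    then have k2: "k < scale (Suc j)" unfolding less_scale_iff using lam by simp
    have jk: "j'' = j" using level_unique[of j'' k j] j'' k1 k2 by auto
    let ?h = "real (block (Suc j))" and ?h' = "real (block j)"
    have pos: "?h > 0" "?h' > 0" using block_pos by auto
    have "real (margin (Suc j)) / ?h \<le> \<bar>real k / ?h' - real n / ?h\<bar>"
      using j'(3) j''(3) block_pos unfolding j(1) jk by (rule blocks_separated)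
    also have "real k / ?h' - real n / ?h
        = ((lam * real k - real n) * ?h + real n * (?h - lam * ?h')) / (lam * ?h' * ?h)"
      using pos lam by (simp add: field_simps)
    also have "\<bar>\<dots>\<bar> = \<bar>(lam * real k - real n) * ?h + real n * (?h - lam * ?h')\<bar> / (lam * ?h' * ?h)"
      using pos lam by (simp add: abs_mult)
    also have "\<dots> \<le> (c * ?h + lam ^ (j + 2) * \<bar>?h - lam * ?h'\<bar>) / (lam * ?h' * ?h)"
    proof (intro divide_right_mono order_trans[OF abs_triangle_ineq] add_mono)
      show "\<bar>(lam * real k - real n) * ?h\<bar> \<le> c * ?h"
        unfolding abs_mult using close c pos by (intro mult_mono) auto
      show "\<bar>real n * (?h - lam * ?h')\<bar> \<le> lam ^ (j + 2) * \<bar>?h - lam * ?h'\<bar>"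
        unfolding abs_mult using n2 by (intro mult_right_mono) auto
    qed (use pos lam in auto)
    finally have "real (margin (Suc j)) \<le> (c * ?h + lam ^ (j + 2) * \<bar>?h - lam * ?h'\<bar>) / (lam * ?h')"
      using pos lam by (simp add: field_simps)
    with i(1)[OF j(2)] show False by linarith
  qed
  then show ?thesis by (intro finite_subset[OF _ finite_lessThan[of "scale (Suc i)"]]) auto
qed

end

section \<open>The two sets\<close>

lemma lower_density_eqI:
  assumes "(\<lambda>N. real (card (A \<inter> {1..N})) / N) \<longlonglongrightarrow> x"
  shows "lower_density A = ereal x"
  unfolding lower_density_def using assms by (intro lim_imp_Liminf) auto

lemma infinite_beyond:
  fixes B :: "nat set"
  assumes "infinite B" "finite F" "inj f"
  obtains b where "b \<in> B" "b \<ge> a" "f b \<notin> F"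
proof -
  have "finite ({..<a} \<union> f -` F)" using assms by (auto intro: finite_vimageI)
  with assms(1) have "\<not> B \<subseteq> {..<a} \<union> f -` F" by (meson finite_subset)
  with that show thesis by force
qed

definition thin_multiples :: "nat \<Rightarrow> nat set \<Rightarrow> nat set" where
  "thin_multiples q E = {n. n \<ge> 1 \<and> (q dvd n \<longrightarrow> n div q \<in> E)}"

text \<open>
  Up to \<open>N\<close>, exactly the numbers \<open>q * k\<close> with \<open>k \<le> N div q\<close> outside \<open>E\<close> are missing, a proportion
  \<open>(1 - x) / q\<close> of all numbers.
\<close>

lemma density_thin_multiples:
  assumes "q > 0" and E: "(\<lambda>N. real (card (E \<inter> {1..N})) / N) \<longlonglongrightarrow> x"
  shows "(\<lambda>N. real (card (thin_multiples q E \<inter> {1..N})) / N) \<longlonglongrightarrow> 1 - (1 - x) / q"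
proof -
  have count: "real (card (thin_multiples q E \<inter> {1..N}))
     = real N - (real (N div q) - real (card (E \<inter> {1..N div q})))" for N
  proof -
    let ?M = "{1..N div q} - E"
    have img: "{1..N} = (thin_multiples q E \<inter> {1..N}) \<union> (\<lambda>k. q * k) ` ?M"
    proof (intro equalityI subsetI)
      fix n assume "n \<in> {1..N}"
      then show "n \<in> (thin_multiples q E \<inter> {1..N}) \<union> (\<lambda>k. q * k) ` ?M"
        using \<open>q > 0\<close> by (cases "q dvd n")
          (auto simp: thin_multiples_def dvd_def less_eq_div_iff_mult_less_eq mult.commute)
    next
      fix n assume "n \<in> (thin_multiples q E \<inter> {1..N}) \<union> (\<lambda>k. q * k) ` ?M"
      then show "n \<in> {1..N}"
        using \<open>q > 0\<close> by (auto simp: less_eq_div_iff_mult_less_eq mult.commute Suc_le_eq)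
    qed
    have "card {1..N} = card (thin_multiples q E \<inter> {1..N}) + card ((\<lambda>k. q * k) ` ?M)"
      by (subst img, rule card_Un_disjoint) (use \<open>q > 0\<close> in \<open>auto simp: thin_multiples_def\<close>)
    also have "card ((\<lambda>k. q * k) ` ?M) = card ?M"
      using \<open>q > 0\<close> by (intro card_image) (auto simp: inj_on_def)
    finally have "N = card (thin_multiples q E \<inter> {1..N}) + card ?M" by simp
    moreover have "N div q = card (E \<inter> {1..N div q}) + card ?M"
      using card_Diff_subset_Int[of "{1..N div q}" E] card_mono[of "{1..N div q}" "E \<inter> {1..N div q}"]
      by (simp add: Int_commute)
    ultimately show ?thesis by linarith
  qed
  have div_lim: "(\<lambda>N. real (N div q) / N) \<longlonglongrightarrow> 1 / q"
  proof (rule tendsto_sandwich)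
    show "\<forall>\<^sub>F N in sequentially. 1 / q - 1 / real N \<le> real (N div q) / N"
      using eventually_gt_at_top[of 0]
    proof eventually_elim
      case (elim N)
      have "N \<le> (N div q + 1) * q" using \<open>q > 0\<close> by (metis add.commute dividend_less_div_times less_imp_le mult.commute mult_Suc plus_1_eq_Suc)
      then have "real N \<le> real ((N div q + 1) * q)" by (rule of_nat_mono)
      then have "real N \<le> (real (N div q) + 1) * q" by (simp only: of_nat_mult of_nat_add of_nat_1)
      then have "real N / q - 1 \<le> real (N div q)" using \<open>q > 0\<close> by (simp add: field_simps)
      then have "(real N / q - 1) / N \<le> real (N div q) / N" by (rule divide_right_mono) simp
      then show ?case using elim by (simp add: diff_divide_distrib)
    qed
    show "\<forall>\<^sub>F N in sequentially. real (N div q) / N \<le> 1 / q"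
      using eventually_gt_at_top[of 0]
    proof eventually_elim
      case (elim N)
      have "real (N div q * q) \<le> real N" by (intro of_nat_mono) simp
      then have "real (N div q) * q \<le> N" by (simp only: of_nat_mult)
      then have "real (N div q) \<le> real N / q" using \<open>q > 0\<close> by (simp add: field_simps)
      then have "real (N div q) / N \<le> real N / q / N" by (rule divide_right_mono) simp
      then show ?case using elim by simp
    qed
    show "(\<lambda>N. 1 / q - 1 / real N) \<longlonglongrightarrow> 1 / real q" by real_asymp
  qed simp
  have "filterlim (\<lambda>N. N div q) at_top sequentially"
    unfolding filterlim_at_top
  proof
    fix K
    show "\<forall>\<^sub>F N in sequentially. K \<le> N div q"
      using eventually_ge_at_top[of "K * q"]
      by eventually_elim (use \<open>q > 0\<close> in \<open>simp add: less_eq_div_iff_mult_less_eq\<close>)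
  qed
  from filterlim_compose[OF E this]
  have "(\<lambda>N. 1 - real (N div q) / N * (1 - real (card (E \<inter> {1..N div q})) / real (N div q)))
      \<longlonglongrightarrow> 1 - 1 / q * (1 - x)"
    by (intro tendsto_intros div_lim)
  moreover have "\<forall>\<^sub>F N in sequentially.
      1 - real (N div q) / N * (1 - real (card (E \<inter> {1..N div q})) / real (N div q))
      = real (card (thin_multiples q E \<inter> {1..N})) / N"
    using eventually_gt_at_top[of 0]
  proof eventually_elim
    case (elim N)
    show ?case unfolding count using elim
      by (cases "N div q = 0") (simp_all add: field_simps)
  qed
  ultimately show ?thesis by (simp add: tendsto_cong)
qed

theorem proposition6p5:
  fixes l m :: nat
  assumes "l \<ge> 1" and "m \<ge> 1"
  shows "\<exists>A A' :: nat set. A \<subseteq> {1..} \<and> A' \<subseteq> {1..} \<and>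
           lower_density A = ereal (1 / 2) \<and>
           lower_density A' = ereal (1 - 1 / (2 * (real l + real m))) \<and>
           (\<forall>B t. B \<subseteq> {1..} \<and> infinite B \<and> t \<ge> 1 \<longrightarrow>
              \<not> translate (weighted_sums m l B) t \<subseteq> A \<and>
              \<not> weighted_sums m l B \<subseteq> A')"
proof -
  define q where "q = l + m"
  define lam where "lam = real q / real l"
  interpret geometric_scales lam
    by unfold_locales (use assms in \<open>simp add: lam_def q_def\<close>)
  let ?E = dilate_avoiding
  have q: "q > 0" using assms by (simp add: q_def)
  have lam_l: "l * (lam * real k - real n) = real q * k - real l * n" for k n
    using assms by (simp add: lam_def field_simps)
  have coincidences: "finite {n \<in> ?E. \<exists>k\<in>?E. real q * k - real l * n = c}" for c
  proof (rule finite_subset[OF _ finite_dilate_coincidences[of "\<bar>c\<bar>"]], safe)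
    fix n k assume "n \<in> ?E" "k \<in> ?E" "c = real q * k - real l * n"
    then have "\<bar>c\<bar> = l * \<bar>lam * real k - real n\<bar>" unfolding lam_l[symmetric] by (simp add: abs_mult)
    moreover have "1 * \<bar>lam * real k - real n\<bar> \<le> l * \<bar>lam * real k - real n\<bar>"
      using assms by (intro mult_right_mono) auto
    ultimately show "\<exists>k'\<in>?E. \<bar>lam * real k' - real n\<bar> \<le> \<bar>real q * k - real l * n\<bar>"
      using \<open>k \<in> ?E\<close> \<open>c = _\<close> by auto
  qed
  have A: "\<not> translate (weighted_sums m l B) t \<subseteq> ?E" if "infinite B" for B t
  proof
    assume sub: "translate (weighted_sums m l B) t \<subseteq> ?E"
    obtain b1 where b1: "b1 \<in> B" using \<open>infinite B\<close> by fastforce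
    \<comment> \<open>The value of \<open>q * k - l * n\<close> for \<open>n = q * b + t\<close> and \<open>k = m * b1 + l * b + t\<close>, whatever \<open>b\<close> is.\<close>
    define c where "c = real q * (m * b1 + t) - real l * t"
    have "inj (\<lambda>b. q * b + t)" using q by (auto simp: inj_def)
    then obtain b where b: "b \<in> B" "b \<ge> b1"
      "q * b + t \<notin> {n \<in> ?E. \<exists>k\<in>?E. real q * k - real l * n = c}"
      using infinite_beyond[OF \<open>infinite B\<close> coincidences[of c]] by blast
    have "(m * b + l * b) + t \<in> ?E" "(m * b1 + l * b) + t \<in> ?E"
      using sub b b1 unfolding translate_def weighted_sums_def by blast+
    moreover have "real q * real ((m * b1 + l * b) + t) - real l * real (q * b + t) = c"
      unfolding c_def by (simp add: algebra_simps)
    ultimately show False using b(3) by (auto simp: q_def algebra_simps)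
  qed
  have A': "\<not> weighted_sums m l B \<subseteq> thin_multiples q ?E" if "infinite B" for B
  proof
    assume sub: "weighted_sums m l B \<subseteq> thin_multiples q ?E"
    have fin: "finite ((\<lambda>b. b mod q) ` B)"
      using q by (intro finite_subset[OF _ finite_lessThan[of q]]) auto
    obtain b1 where b1: "b1 \<in> B" "infinite {b \<in> B. b mod q = b1 mod q}"
      using pigeonhole_infinite[OF \<open>infinite B\<close> fin] by blast
    define c where "c = real m * b1"
    obtain b where b: "b \<in> B" "b mod q = b1 mod q" "b \<ge> b1"
      "b \<notin> {n \<in> ?E. \<exists>k\<in>?E. real q * k - real l * n = c}"
      using infinite_beyond[OF b1(2) coincidences[of c] inj_on_id, of b1] by auto
    have "(m * b1 + l * b) mod q = (m * b + l * b) mod q"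
      using b(2) by (metis mod_add_left_eq mod_mult_right_eq)
    also have "m * b + l * b = q * b" by (simp add: q_def algebra_simps)
    finally have "q dvd m * b1 + l * b" by (simp add: dvd_eq_mod_eq_0)
    then obtain k where k: "m * b1 + l * b = q * k" by (rule dvdE)
    have "m * b + l * b \<in> thin_multiples q ?E" "m * b1 + l * b \<in> thin_multiples q ?E"
      using sub b b1 unfolding weighted_sums_def by blast+
    then have "b \<in> ?E" "k \<in> ?E"
      unfolding k \<open>m * b + l * b = q * b\<close> using q by (auto simp: thin_multiples_def)
    moreover have "real q * k - real l * b = c"
      unfolding c_def using arg_cong[OF k, of real] by simp
    ultimately show False using b(4) by blast
  qed
  show ?thesis
  proof (rule exI[of _ ?E], rule exI[of _ "thin_multiples q ?E"], intro conjI allI impI)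
    show "?E \<subseteq> {1..}" by (rule dilate_avoiding_positive)
    show "thin_multiples q ?E \<subseteq> {1..}" by (auto simp: thin_multiples_def)
    show "lower_density ?E = ereal (1 / 2)"
      by (rule lower_density_eqI[OF density_dilate_avoiding])
    show "lower_density (thin_multiples q ?E) = ereal (1 - 1 / (2 * (real l + real m)))"
      using lower_density_eqI[OF density_thin_multiples[OF q density_dilate_avoiding]]
      by (simp add: q_def)
    fix B :: "nat set" and t :: nat
    assume "B \<subseteq> {1..} \<and> infinite B \<and> t \<ge> 1"
    then have B: "infinite B" by blast
    show "\<not> translate (weighted_sums m l B) t \<subseteq> ?E" using B by (rule A)
    show "\<not> weighted_sums m l B \<subseteq> thin_multiples q ?E" using B by (rule A')
  qed
qed

end
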